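(* For every positive integer $k$, there exists a (finite) binary tree $G$ such that $s(G)>k$.
   Context: A vertex labeling of a graph $G$ is an injective map $f:V(G)\to\mathbb{Z}$. It induces the edge labeling $f^+:E(G)\to\mathbb{Z}$, $f^+(uv)=f(u)+f(v)$, and $|f^+|$ denotes the number of distinct values $f^+$ takes on $E(G)$. The sum index $s(G)$ is the minimum positive integer $k$ such that there exists a vertex labeling $f$ of $G$ with $|f^+|=k$. A binary tree is a tree with a designated root in which every vertex has at most two children. *)

theory Defs
  imports "Graph_Theory.Graph_Theory"
begin

text \<open>
  A finite simple graph is a \<^locale>\<open>pair_graph\<close>: every undirected edge \<open>uv\<close> is represented by
  the two arcs \<open>(u,v)\<close> and \<open>(v,u)\<close>.
\<close>

section \<open>Sum index\<close>

definition vertex_labeling :: "'a pair_pre_digraph \<Rightarrow> ('a \<Rightarrow> int) \<Rightarrow> bool" where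
  "vertex_labeling G f \<longleftrightarrow> inj_on f (pverts G)"

text \<open>The two arcs representing an edge get the same label, so this is a labeling of the edges.\<close>

definition induced_edge_label :: "('a \<Rightarrow> int) \<Rightarrow> 'a \<times> 'a \<Rightarrow> int" where
  "induced_edge_label f e = f (fst e) + f (snd e)"

definition num_edge_labels :: "'a pair_pre_digraph \<Rightarrow> ('a \<Rightarrow> int) \<Rightarrow> nat" where
  "num_edge_labels G f = card (induced_edge_label f ` parcs G)"

text \<open>
  For a finite graph with at least one edge the set below is nonempty and \<open>Inf\<close> is its minimum.
  For an edgeless graph no positive integer is admissible, and the value is \<open>0\<close>.
\<close>

definition sum_index :: "'a pair_pre_digraph \<Rightarrow> nat" where
  "sum_index G = Inf {k. 0 < k \<and> (\<exists>f. vertex_labeling G f \<and> num_edge_labels G f = k)}"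

lemma sum_index_attained:
  assumes "pair_graph G" and "parcs G \<noteq> {}"
  obtains f where "vertex_labeling G f" and "num_edge_labels G f = sum_index G" and "0 < sum_index G"
proof -
  let ?S = "{k. 0 < k \<and> (\<exists>f. vertex_labeling G f \<and> num_edge_labels G f = k)}"
  interpret pair_graph G by fact
  obtain h :: "'a \<Rightarrow> nat" where h: "inj_on h (pverts G)"
    using finite_imp_inj_to_nat_seg[OF pair_finite_verts] by blast
  then have "vertex_labeling G (int \<circ> h)"
    unfolding vertex_labeling_def by (intro comp_inj_on) (auto simp: inj_on_def)
  moreover have "0 < num_edge_labels G (int \<circ> h)"
    unfolding num_edge_labels_def using assms(2) pair_finite_arcs by (simp add: card_gt_0_iff)
  ultimately have "?S \<noteq> {}" by blast
  then have "Inf ?S \<in> ?S" by (rule Inf_nat_def1)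
  then show thesis using that unfolding sum_index_def by blast
qed

section \<open>Binary trees\<close>

text \<open>
  In the bidirected representation an edge traversed back and forth is a \<^const>\<open>pre_digraph.cycle\<close>
  of length 2, so the library's notion of tree, which forbids all directed cycles, is not usable here.
  The cycles of the undirected graph are the directed cycles of length at least 3.
\<close>

definition undirected_tree :: "'a pair_pre_digraph \<Rightarrow> bool" where
  "undirected_tree G \<longleftrightarrow> pair_graph G \<and> connected (with_proj G) \<and>
     \<not> (\<exists>p. pre_digraph.cycle (with_proj G) p \<and> 3 \<le> length p)"

text \<open>The vertex \<open>v\<close> is a child of \<open>u\<close> iff \<open>uv\<close> is the last edge of the path from the root to \<open>v\<close>.\<close>

definition children :: "'a pair_pre_digraph \<Rightarrow> 'a \<Rightarrow> 'a \<Rightarrow> 'a set" where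
  "children G r u = {v. \<exists>p. pre_digraph.apath (with_proj G) r (p @ [(u, v)]) v}"

definition binary_tree :: "'a pair_pre_digraph \<Rightarrow> 'a \<Rightarrow> bool" where
  "binary_tree G r \<longleftrightarrow> undirected_tree G \<and> r \<in> pverts G \<and>
     (\<forall>u \<in> pverts G. card (children G r u) \<le> 2)"

end

theory Submission
  imports Defs
begin

text \<open>
  A labeling with few edge labels leaves little room near any vertex. If \<open>s\<close> is the label of the
  edge \<open>uv\<close>, then \<open>f v = s - f u\<close>; so along a walk starting in \<open>r\<close> the vertex label is always
  \<open>\<plusminus> f r\<close> plus an integer combination of the edge labels. A walk of length at most \<open>d\<close> only produces
  coefficients in \<open>{-d..d}\<close>. The order of the steps is forgotten, and with at most \<open>k\<close> edge
  labels only \<open>2 * (2 * d + 1) ^ k\<close> values can occur within distance \<open>d\<close> of \<open>r\<close>. Since \<open>f\<close> is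
  injective, this polynomial in \<open>d\<close> bounds the number of vertices there
  (\<open>card_le_of_few_edge_labels\<close>).

  The complete binary tree of depth \<open>d\<close> has \<open>2 ^ Suc d - 1\<close> vertices, all within distance \<open>d\<close> of
  its root, so for large \<open>d\<close> it needs more than \<open>k\<close> edge labels
  (\<open>polynomial_less_exponential\<close>). It is realised on the numbers \<open>1, \<dots>, 2 ^ Suc d - 1\<close> as a binary
  heap, in which the parent of \<open>v\<close> is \<open>v div 2\<close>. Parents are smaller than their children, which
  excludes cycles: the largest vertex of a cycle would have its parent as its successor as well as its
  predecessor (\<open>heap_tree_cycle_length\<close>).
\<close>

section \<open>Few edge labels force slow growth\<close>

text \<open>
  Every arc of the walk flips the sign of all that was accumulated and changes the coefficient of
  its own label by one, so the coefficients grow at most as fast as the walk.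
\<close>

lemma label_along_walk:
  assumes "pair_graph G"
    and "pre_digraph.awalk (with_proj G) u p v"
  shows "\<exists>e \<in> {1, -1}. \<exists>c. (\<forall>s. \<bar>c s\<bar> \<le> int (length p)) \<and>
    f v = e * f u + (\<Sum>s \<in> induced_edge_label f ` parcs G. c s * s)"
    (is "\<exists>e \<in> _. \<exists>c. ?P e c u p")
proof -
  interpret pair_graph G by fact
  let ?S = "induced_edge_label f ` parcs G"
  have fin: "finite ?S" using pair_finite_arcs by simp
  show ?thesis
    using assms(2)
  proof (induction p arbitrary: u)
    case Nil
    then have "f v = 1 * f u + (\<Sum>s \<in> ?S. 0 * s)" by (simp add: awalk_Nil_iff)
    then show ?case by (intro bexI[of _ 1] exI[of _ "\<lambda>_. 0"]) auto
  next
    case (Cons a p)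
    then have a: "a \<in> parcs G" "u = fst a" and w: "awalk (snd a) p v"
      by (auto simp: awalk_Cons_iff)
    let ?s = "induced_edge_label f a"
    from Cons.IH[OF w] obtain e c where e: "e \<in> {1, -1}" and c: "?P e c (snd a) p" by blast
    let ?c = "\<lambda>s. c s + (if s = ?s then e else 0)"
    have "\<bar>?c s\<bar> \<le> int (length (a # p))" for s
      using c e by (auto dest!: spec[of _ s])
    moreover have "f v = - e * f u + (\<Sum>s \<in> ?S. ?c s * s)"
    proof -
      have "?c s * s = c s * s + (if s = ?s then e * s else 0)" for s
        by (simp add: distrib_right)
      then have "(\<Sum>s \<in> ?S. ?c s * s) = (\<Sum>s \<in> ?S. c s * s) + e * ?s"
        using fin a by (simp add: sum.distrib)
      then show ?thesis
        using c a by (simp add: induced_edge_label_def distrib_left)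
    qed
    moreover have "- e \<in> {1, -1}" using e by auto
    ultimately show ?case by (intro bexI[of _ "- e"] exI[of _ ?c]) auto
  qed
qed

text \<open>
  Every vertex label is determined by a sign and one coefficient for each edge label, and distinct
  vertices have distinct labels. The number of edge labels enters only as the exponent, so for
  fixed \<open>k\<close> the bound is polynomial in the radius \<open>d\<close>.
\<close>

lemma card_le_of_few_edge_labels:
  assumes G: "pair_graph G"
    and f: "vertex_labeling G f"
    and few: "num_edge_labels G f \<le> k"
    and near: "\<And>v. v \<in> pverts G \<Longrightarrow>
      \<exists>p. pre_digraph.awalk (with_proj G) r p v \<and> length p \<le> d"
  shows "card (pverts G) \<le> 2 * (2 * d + 1) ^ k"
proof -
  interpret pair_graph G by fact
  let ?S = "induced_edge_label f ` parcs G"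
  let ?I = "{- int d..int d}"
  let ?D = "{1, -1 :: int} \<times> (?S \<rightarrow>\<^sub>E ?I)"
  let ?val = "\<lambda>(e, c). e * f r + (\<Sum>s \<in> ?S. c s * s)"
  have fin: "finite ?S" using pair_finite_arcs by simp
  then have finD: "finite ?D" by (auto intro!: finite_PiE)
  \<comment> \<open>The coefficients matter only on \<open>?S\<close>; restricting them there makes the parameter set finite.\<close>
  have "f ` pverts G \<subseteq> ?val ` ?D"
  proof
    fix y assume "y \<in> f ` pverts G"
    then obtain v p where y: "y = f v" and p: "awalk r p v" "length p \<le> d"
      using near by blast
    obtain e c where e: "e \<in> {1, -1}" and c: "\<And>s. \<bar>c s\<bar> \<le> int (length p)"
      and val: "f v = e * f r + (\<Sum>s \<in> ?S. c s * s)"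
      using label_along_walk[OF G p(1), of f] by blast
    have "- int d \<le> c s \<and> c s \<le> int d" for s using c[of s] p(2) by linarith
    then have "(e, restrict c ?S) \<in> ?D" using e by (auto simp: restrict_def)
    moreover have "y = ?val (e, restrict c ?S)" using y val by simp
    ultimately show "y \<in> ?val ` ?D" by (rule rev_image_eqI)
  qed
  then have "card (f ` pverts G) \<le> card ?D"
    by (rule surj_card_le[OF finD])
  moreover have "card (f ` pverts G) = card (pverts G)"
    using f by (simp add: vertex_labeling_def card_image)
  moreover have "card ?D = 2 * (2 * d + 1) ^ card ?S"
  proof -
    have "card ?I = 2 * d + 1" by simp
    then show ?thesis using fin by (simp add: card_cartesian_product card_PiE)
  qed
  moreover have "(2 * d + 1) ^ card ?S \<le> (2 * d + 1) ^ k"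
    using few by (intro power_increasing) (auto simp: num_edge_labels_def)
  ultimately show ?thesis by simp
qed

section \<open>Binary heaps as trees\<close>

text \<open>
  For positive \<open>v\<close> the parent \<open>v div 2\<close> is smaller than \<open>v\<close>. The root \<open>1\<close> has no parent because
  \<open>1 div 2 = 0\<close> is not a vertex.
\<close>

definition heap_tree :: "nat \<Rightarrow> nat pair_pre_digraph" where
  "heap_tree n = \<lparr> pverts = {1..n},
     parcs = {(u, v). u \<in> {1..n} \<and> v \<in> {1..n} \<and> (u = v div 2 \<or> v = u div 2)} \<rparr>"

lemma pverts_heap_tree [simp]: "pverts (heap_tree n) = {1..n}"
  by (simp add: heap_tree_def)

lemma parcs_heap_tree_iff:
  "(u, v) \<in> parcs (heap_tree n) \<longleftrightarrow>
     u \<in> {1..n} \<and> v \<in> {1..n} \<and> (u = v div 2 \<or> v = u div 2)"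
  by (simp add: heap_tree_def)

lemma pair_graph_heap_tree: "pair_graph (heap_tree n)"
proof
  have "parcs (heap_tree n) \<subseteq> {1..n} \<times> {1..n}"
    by (auto simp: parcs_heap_tree_iff)
  then show "finite (parcs (heap_tree n))"
    by (rule finite_subset) simp
qed (auto simp: parcs_heap_tree_iff symmetric_def sym_def)

interpretation heap: pair_graph "heap_tree n" for n
  by (rule pair_graph_heap_tree)

text \<open>The condition \<open>v < 2 ^ Suc d\<close> says that \<open>v\<close> has at most \<open>d\<close> proper ancestors.\<close>

lemma heap_tree_walk_from_root:
  assumes "1 \<le> v" "v \<le> n" "v < 2 ^ Suc d"
  shows "\<exists>p. heap.awalk n 1 p v \<and> length p \<le> d"
  using assms
proof (induction d arbitrary: v)
  case 0
  then show ?case by (intro exI[of _ "[]"]) (auto simp: heap.awalk_Nil_iff)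
next
  case (Suc d)
  show ?case
  proof (cases "v = 1")
    case True
    with Suc.prems show ?thesis by (intro exI[of _ "[]"]) (auto simp: heap.awalk_Nil_iff)
  next
    case False
    then have "1 \<le> v div 2" "v div 2 \<le> n" "v div 2 < 2 ^ Suc d"
      using Suc.prems by auto
    then obtain p where p: "heap.awalk n 1 p (v div 2)" "length p \<le> d"
      using Suc.IH by blast
    have "(v div 2, v) \<in> parcs (heap_tree n)"
      using Suc.prems False by (auto simp: parcs_heap_tree_iff)
    then have "heap.awalk n (v div 2) [(v div 2, v)] v"
      using heap.arc_implies_awalk[of "(v div 2, v)" n] by simp
    with p(1) have "heap.awalk n 1 (p @ [(v div 2, v)]) v"
      by (rule heap.awalk_appendI)
    then show ?thesis using p(2) by (intro exI[of _ "p @ [(v div 2, v)]"]) auto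
  qed
qed

lemma connected_heap_tree:
  assumes "1 \<le> n"
  shows "connected (with_proj (heap_tree n))"
proof -
  let ?G = "with_proj (heap_tree n)"
  have from_root: "1 \<rightarrow>\<^sup>*\<^bsub>?G\<^esub> v" if "v \<in> {1..n}" for v
  proof -
    have "v < 2 ^ Suc v" by (metis less_exp Suc_lessD)
    then show ?thesis
      using heap_tree_walk_from_root[of v n v] that heap.reachable_awalkI by auto
  qed
  have "u \<rightarrow>\<^sup>*\<^bsub>?G\<^esub> v" if "u \<in> {1..n}" "v \<in> {1..n}" for u v
    using heap.symmetric_reachable'[OF from_root[OF that(1)]] from_root[OF that(2)]
    by (rule heap.reachable_trans)
  then have "strongly_connected ?G" using assms by (intro strongly_connectedI) auto
  then show ?thesis
    unfolding connected_def strongly_connected_def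
    using heap.reachable_mk_symmetricI by auto
qed

text \<open>
  At the largest vertex of a cycle both neighbours on the cycle are smaller, hence both are the
  parent. As the vertices of a cycle are distinct, the positions before and after the maximum agree
  modulo the length, which leaves only the back-and-forth traversal of an edge.
\<close>

lemma heap_tree_cycle_length:
  assumes cyc: "heap.cycle n p"
  shows "length p < 3"
proof (rule ccontr)
  assume "\<not> length p < 3"
  then have len: "3 \<le> length p" by simp
  obtain u where walk: "heap.awalk n u p u" and dist: "distinct (tl (pawalk_verts u p))"
    using cyc by (auto simp: heap.cycle_def)
  let ?l = "length p"
  \<comment> \<open>The vertices of the cycle indexed cyclically, so that the maximum may sit at the seam.\<close>
  let ?w = "\<lambda>i. snd (p ! (i mod ?l))"
  have p: "p \<noteq> []" using len by auto
  have cas: "pcas u p u" and arcs: "set p \<subseteq> parcs (heap_tree n)"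
    using walk by (auto simp: heap.awalk_def)
  have verts: "pawalk_verts u p = fst (hd p) # map snd p"
    using heap.awalk_verts_conv'[OF cas] p by simp
  have step: "(?w i, ?w (Suc i)) \<in> parcs (heap_tree n)" for i
  proof -
    have lt: "Suc i mod ?l < ?l" using p by simp
    have "?w i = fst (p ! (Suc i mod ?l))"
    proof (cases "Suc i mod ?l = 0")
      case True
      then have "i mod ?l = ?l - 1" by (simp add: mod_Suc split: if_splits)
      moreover have "snd (last p) = u" "fst (hd p) = u"
        using heap.awlast_of_awalk[OF walk] heap.awhd_of_awalk[OF walk] p
        by (auto simp: heap.awalk_verts_conv last_map hd_map)
      ultimately show ?thesis using True p by (simp add: last_conv_nth hd_conv_nth)
    next
      case False
      then have "Suc i mod ?l = Suc (i mod ?l)" by (simp add: mod_Suc split: if_splits)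
      moreover have "map fst p @ [snd (last p)] = fst (hd p) # map snd p"
        using heap.awalk_verts_conv[of u p] verts p by simp
      then have "(map fst p @ [snd (last p)]) ! Suc (i mod ?l) = map snd p ! (i mod ?l)"
        by simp
      ultimately show ?thesis using lt by (simp add: nth_append)
    qed
    then have "(?w i, ?w (Suc i)) = p ! (Suc i mod ?l)" by (simp add: prod_eq_iff)
    then show ?thesis using arcs nth_mem[OF lt] by auto
  qed
  obtain m where m: "m < ?l" and max: "\<And>i. i < ?l \<Longrightarrow> snd (p ! i) \<le> snd (p ! m)"
  proof -
    have "Max (snd ` set p) \<in> snd ` set p" using p by (intro Max_in) auto
    then obtain m where "m < ?l" "snd (p ! m) = Max (snd ` set p)"
      by (auto simp: in_set_conv_nth)
    then show thesis using that by (auto intro!: Max_ge)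
  qed
  have parent: "y = snd (p ! m) div 2"
    if "y \<le> snd (p ! m)" "(y, snd (p ! m)) \<in> parcs (heap_tree n)" for y
    using that by (auto simp: parcs_heap_tree_iff)
  have "?w (m + 1) = snd (p ! m) div 2"
    using step[of m] m max p
    by (intro parent) (auto simp: parcs_heap_tree_iff)
  moreover have "?w (m + ?l - 1) = snd (p ! m) div 2"
    using step[of "m + ?l - 1"] m max p by (intro parent) auto
  ultimately have "(m + 1) mod ?l = (m + ?l - 1) mod ?l"
    using dist verts p by (simp add: distinct_conv_nth) (metis mod_less_divisor length_greater_0_conv)
  moreover have "(m + 1) mod ?l = (if m + 1 = ?l then 0 else m + 1)"
    using m by auto
  moreover have "(m + ?l - 1) mod ?l = (if m = 0 then ?l - 1 else m - 1)"
  proof (cases m)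
    case (Suc j)
    then have "m + ?l - 1 = j + ?l" by simp
    then show ?thesis using Suc m by simp
  qed (use p in auto)
  ultimately show False using len m by (auto split: if_splits)
qed

text \<open>
  A path from the root never goes up: its first step leads to a child, and after a step from
  \<open>u div 2\<close> down to \<open>u\<close>, going up would revisit \<open>u div 2\<close>. So the children of \<open>u\<close> in the sense of
  \<^const>\<open>children\<close> are among \<open>2 * u\<close> and \<open>2 * u + 1\<close>.
\<close>

lemma heap_tree_apath_step:
  assumes "heap.apath n 1 (p @ [(u, v)]) v"
  shows "u = v div 2"
  using assms
proof (induction p arbitrary: u v rule: rev_induct)
  case Nil
  then show ?case by (auto simp: heap.apath_Cons_iff parcs_heap_tree_iff)
next
  case (snoc a p)
  obtain t u' where a: "a = (t, u')" by (cases a)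
  have path: "heap.apath n 1 ((p @ [a]) @ [(u, v)]) v"
    using snoc.prems .
  then have arc: "(u, v) \<in> parcs (heap_tree n)" and last: "last (pawalk_verts 1 (p @ [a])) = u"
    and path': "heap.apath n 1 (p @ [a]) u"
    and new: "v \<notin> set (pawalk_verts 1 (p @ [a]))"
    unfolding heap.apath_append_iff[of n 1 "p @ [a]"] heap.apath_Cons_iff by auto
  have u': "u' = u" using last heap.awalk_verts_conv[of 1 "p @ [a]"] a by simp
  have "t = u div 2" using snoc.IH path' by (simp add: a u')
  moreover have "t \<noteq> v" using new heap.awalk_verts_conv[of 1 "p @ [a]"] a by auto
  ultimately show ?case using arc by (auto simp: parcs_heap_tree_iff)
qed

lemma binary_tree_heap_tree:
  assumes "1 \<le> n"
  shows "binary_tree (heap_tree n) 1"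
proof -
  have "card (children (heap_tree n) 1 u) \<le> 2" for u
  proof -
    have "children (heap_tree n) 1 u \<subseteq> {2 * u, 2 * u + 1}"
      using heap_tree_apath_step[of n _ u] by (fastforce simp: children_def)
    then have "card (children (heap_tree n) 1 u) \<le> card {2 * u, 2 * u + 1}"
      by (intro card_mono) auto
    then show ?thesis by simp
  qed
  then show ?thesis
    using assms connected_heap_tree pair_graph_heap_tree heap_tree_cycle_length
    by (fastforce simp: binary_tree_def undirected_tree_def)
qed

section \<open>Polynomial against exponential growth\<close>

text \<open>
  Choosing \<open>d\<close> as a power \<open>2 ^ m\<close> turns the polynomial into the power
  \<open>2 ^ Suc ((m + 2) * k)\<close>. It then suffices that this exponent, linear in \<open>m\<close>, is at most \<open>2 ^ m\<close>.
\<close>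

lemma polynomial_less_exponential:
  "\<exists>d \<ge> 1. 2 * (2 * d + 1) ^ k < (2::nat) ^ Suc d - 1"
proof -
  \<comment> \<open>With this \<open>m\<close> the new exponent is below \<open>4 * (k + 1) ^ 2\<close>, and \<open>2 ^ m = 4 * (2 ^ k) ^ 2\<close>.\<close>
  define m where "m = 2 * k + 2"
  define d :: nat where "d = 2 ^ m"
  have d1: "1 \<le> d" by (simp add: d_def)
  have "2 * (2 * d + 1) ^ k \<le> 2 * (2 ^ (m + 2)) ^ k"
    using d1 by (intro mult_left_mono power_mono) (auto simp: d_def)
  also have "\<dots> = 2 ^ Suc ((m + 2) * k)" by (simp only: power_Suc power_mult)
  also have "\<dots> \<le> 2 ^ d"
  proof (intro power_increasing)
    have "k + 1 \<le> 2 ^ k" by (simp add: Suc_le_eq)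
    then have "(k + 1) ^ 2 \<le> (2 ^ k) ^ 2" by (rule power_mono) simp
    also have "\<dots> = 2 ^ (2 * k)" by (simp add: power_mult mult.commute)
    finally have "4 * (k + 1) ^ 2 \<le> d" by (simp add: d_def m_def)
    then show "Suc ((m + 2) * k) \<le> d" by (simp add: m_def power2_eq_square algebra_simps)
  qed simp
  also have "\<dots> < 2 ^ Suc d - 1"
  proof -
    have "2 ^ 1 \<le> (2::nat) ^ d" using d1 by (intro power_increasing) auto
    then show ?thesis by simp
  qed
  finally show ?thesis using d1 by blast
qed

theorem corollary2p26:
  fixes k :: nat
  assumes "0 < k"
  shows "\<exists>(G :: nat pair_pre_digraph) r. binary_tree G r \<and> sum_index G > k"
proof -
  obtain d where d: "1 \<le> d" "2 * (2 * d + 1) ^ k < (2::nat) ^ Suc d - 1"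
    using polynomial_less_exponential by blast
  let ?n = "2 ^ Suc d - 1 :: nat"
  have "2 ^ 2 \<le> (2::nat) ^ Suc d" using d(1) by (intro power_increasing) auto
  then have n: "2 \<le> ?n" by simp
  then have "(1, 2) \<in> parcs (heap_tree ?n)" by (auto simp: parcs_heap_tree_iff)
  then obtain f where f: "vertex_labeling (heap_tree ?n) f"
    and num: "num_edge_labels (heap_tree ?n) f = sum_index (heap_tree ?n)"
    using sum_index_attained[OF pair_graph_heap_tree] by blast
  have "k < sum_index (heap_tree ?n)"
  proof (rule ccontr)
    assume "\<not> k < sum_index (heap_tree ?n)"
    then have "card (pverts (heap_tree ?n)) \<le> 2 * (2 * d + 1) ^ k"
      using num
      by (intro card_le_of_few_edge_labels[OF pair_graph_heap_tree f, where r = 1]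
          heap_tree_walk_from_root) auto
    then show False using d(2) by simp
  qed
  moreover have "binary_tree (heap_tree ?n) 1"
    using n by (intro binary_tree_heap_tree) simp
  ultimately show ?thesis by blast
qed

end
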